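(* Let $p\in[0,1]$, let $\rho$ be an $\mathbb{N}$-valued random variable, and suppose that $$l := \liminf_{j \to \infty} j\, \mathbb{P}(\rho \geq j) > 1 \quad\text{and}\quad L:= \limsup_{j \to \infty} j\, \mathbb{P}(\rho \geq j) < \infty.$$ Let $D\subseteq\mathbb{R}$ be the random region of the firework process among sceptics with parameter $p$ and radius distribution $\rho$, as defined in the context. Then the firework process percolates among sceptics if $p>1/l$ and does not percolate among sceptics if $p<1/L$; that is, $$\mathbb{P}\{ D \supseteq [t, \infty) \text{ for some finite } t \} = \begin{cases} 1 & \text{ if } p > 1/l,\\ 0 & \text{ if } p < 1/L. \end{cases}$$
   Context: $\mathbb{N}=\{0,1,2,\dots\}$. Let $X_1,X_2,\dots$ be i.i.d. Bernoulli($p$) random variables ($X_i=1$ with probability $p$ and $X_i=0$ with probability $1-p$), and set $X_{-1}=X_0\equiv 1$. Let $\{\rho_i : i\ge -1\}$ be i.i.d. $\mathbb{N}$-valued random variables with the same distribution as $\rho$, independent of $\{X_i : i\ge 1\}$. (An individual sits at each integer $i\ge -1$; an individual at $i$ with $X_i=1$ covers the interval $[i,i+\rho_i]$; a sceptic requires the rumour from two distinct sources.) Define $$D := \{x \in \mathbb{R}: \text{there exist integers } j, k \geq -1 \text{ with } j \neq k,\ X_j= X_k = 1 \text{ and } x \in [j, j + \rho_j] \cap [k, k+ \rho_k]\}.$$ The firework process is said to percolate among sceptics if, with probability $1$, $D$ contains $[t,\infty)$ for some $t\ge 1$. *)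

theory Defs
  imports "HOL-Probability.Probability"
begin

text \<open>
  \<open>N\<close> and \<open>\<rho>\<close> carry the radius distribution and need not live on the same space as the process.
  The families \<open>X\<close> and \<open>R\<close> (the individual radii) are indexed by \<open>int\<close>; their values
  at indices below \<open>-1\<close> are unconstrained and never used.
\<close>

locale firework_process = prob_space M + radius: prob_space N
  for M :: "'a measure" and N :: "'b measure" +
  fixes p :: real
    and \<rho> :: "'b \<Rightarrow> nat"
    and X :: "int \<Rightarrow> 'a \<Rightarrow> nat"
    and R :: "int \<Rightarrow> 'a \<Rightarrow> nat"
  assumes radius_measurable: "\<rho> \<in> measurable N (count_space UNIV)"
    and X_initial: "\<And>i \<omega>. i \<in> {-1, 0} \<Longrightarrow> \<omega> \<in> space M \<Longrightarrow> X i \<omega> = 1"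
    and X_indep: "indep_vars (\<lambda>_. count_space UNIV) X {1..}"
    and X_one: "\<And>i. 1 \<le> i \<Longrightarrow> prob {\<omega> \<in> space M. X i \<omega> = 1} = p"
    and X_zero: "\<And>i. 1 \<le> i \<Longrightarrow> prob {\<omega> \<in> space M. X i \<omega> = 0} = 1 - p"
    and R_indep: "indep_vars (\<lambda>_. count_space UNIV) R {-1..}"
    and R_distr: "\<And>i. -1 \<le> i \<Longrightarrow>
          distr M (count_space UNIV) (R i) = distr N (count_space UNIV) \<rho>"
    and X_R_indep: "indep_var
          (PiM {1..} (\<lambda>_. count_space UNIV)) (\<lambda>\<omega>. restrict (\<lambda>i. X i \<omega>) {1..})
          (PiM {-1..} (\<lambda>_. count_space UNIV)) (\<lambda>\<omega>. restrict (\<lambda>i. R i \<omega>) {-1..})"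

definition sceptic_region :: "(int \<Rightarrow> 'a \<Rightarrow> nat) \<Rightarrow> (int \<Rightarrow> 'a \<Rightarrow> nat) \<Rightarrow> 'a \<Rightarrow> real set" where
  "sceptic_region X R \<omega> = {x. \<exists>j k. -1 \<le> j \<and> -1 \<le> k \<and> j \<noteq> k \<and> X j \<omega> = 1 \<and> X k \<omega> = 1 \<and>
     x \<in> {of_int j .. of_int j + of_nat (R j \<omega>)} \<inter> {of_int k .. of_int k + of_nat (R k \<omega>)}}"

definition percolates_among_sceptics ::
    "'a measure \<Rightarrow> (int \<Rightarrow> 'a \<Rightarrow> nat) \<Rightarrow> (int \<Rightarrow> 'a \<Rightarrow> nat) \<Rightarrow> bool" where
  "percolates_among_sceptics M X R \<longleftrightarrow>
     (AE \<omega> in M. \<exists>t\<ge>1. {t..} \<subseteq> sceptic_region X R \<omega>)"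

end

theory Submission
  imports Defs
begin

text \<open>
  Up to the finitely many edges reached from \<open>-1\<close> and \<open>0\<close>, whether the edge \<open>[n, n + 1]\<close> is covered
  depends only on the i.i.d. effective radii \<open>R\<^sub>i\<close> if \<open>X\<^sub>i = 1\<close>, else \<open>0\<close>, whose tail is
  \<open>a\<^sub>k = p P(\<rho> \<ge> k)\<close>.
  If \<open>a\<^sub>k \<ge> c / k\<close> eventually with \<open>c > 1\<close>, then for \<open>S\<^sub>n\<close> the number of sources covering the edge,
  Markov's inequality for \<open>e ^ S\<^sub>n\<close> with small \<open>e > 0\<close> gives
  \<open>P(S\<^sub>n \<le> 1) \<le> (1 / e) \<Prod>\<^sub>k (1 - (1 - e) a\<^sub>k) = O(n powr (- (1 - e) c))\<close>, which is summable, and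
  Borel--Cantelli applies.
  If \<open>a\<^sub>k \<le> 1 / k\<close> eventually, the uncovered edges form a renewal process with renewal probabilities
  \<open>u\<^sub>n = \<Prod>\<^sub>k (1 - a\<^sub>k) \<ge> C / n\<close>. Decomposing according to the last renewal gives
  \<open>q \<Sum>\<^sub>n u\<^sub>n \<le> 1\<close> for the probability \<open>q\<close> of no return, so \<open>q = 0\<close> and uncovered edges recur
  almost surely.
\<close>

section \<open>Summability and divergence of sums of products\<close>

text \<open>From \<open>1 - x \<le> exp (- x)\<close> and \<open>ln (1 + x) \<le> x\<close>, the
  sequence \<open>P n * real (Suc n) powr d\<close> is eventually nonincreasing. Hence
  \<open>P n\<close> is bounded by a multiple of \<open>real (Suc n) powr (- d)\<close>, which is
  summable because \<open>1 < d\<close>.\<close>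

lemma summable_prod_one_minus:
  fixes b :: "nat \<Rightarrow> real"
  assumes b: "\<And>k. 0 \<le> b k" "\<And>k. b k \<le> 1" and d: "1 < d"
    and ev: "\<forall>\<^sub>F k in sequentially. d / real k \<le> b k"
  shows "summable (\<lambda>n. \<Prod>i<n. 1 - b (Suc i))"
proof -
  define P where "P n = (\<Prod>i<n. 1 - b (Suc i))" for n
  have P0: "0 \<le> P n" for n unfolding P_def using b by (intro prod_nonneg) auto
  obtain K where K: "\<And>k. K \<le> k \<Longrightarrow> d / real k \<le> b k"
    using ev by (auto simp: eventually_sequentially)
  have decay: "(1 - b (Suc n)) * real (Suc (Suc n)) powr d \<le> real (Suc n) powr d" if "K \<le> n" for n
  proof -
    have "1 + 1 / real (Suc n) = real (Suc (Suc n)) / real (Suc n)" by (simp add: field_simps)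
    then have "ln (real (Suc (Suc n))) - ln (real (Suc n)) = ln (1 + 1 / real (Suc n))"
      using ln_div[of "real (Suc (Suc n))" "real (Suc n)"] by simp
    also have "\<dots> \<le> 1 / real (Suc n)"
      by (rule ln_add_one_self_le_self) auto
    finally have "d * (ln (real (Suc (Suc n))) - ln (real (Suc n))) \<le> d * (1 / real (Suc n))"
      using d by (intro mult_left_mono) auto
    then have 1: "- d / real (Suc n) + d * ln (real (Suc (Suc n))) \<le> d * ln (real (Suc n))"
      by (simp add: algebra_simps)
    have "1 - b (Suc n) \<le> 1 + (- d / real (Suc n))"
      using K[of "Suc n"] that by simp
    also have "\<dots> \<le> exp (- d / real (Suc n))" by (rule exp_ge_add_one_self)
    finally have "(1 - b (Suc n)) * real (Suc (Suc n)) powr d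
        \<le> exp (- d / real (Suc n)) * real (Suc (Suc n)) powr d"
      by (intro mult_right_mono) auto
    also have "\<dots> = exp (- d / real (Suc n) + d * ln (real (Suc (Suc n))))"
      by (simp add: powr_def exp_add[symmetric])
    also have "\<dots> \<le> exp (d * ln (real (Suc n)))" using 1 by simp
    finally show ?thesis by (simp add: powr_def)
  qed
  have bd: "P n * real (Suc n) powr d \<le> P K * real (Suc K) powr d" if "K \<le> n" for n
    using that
  proof (induction n rule: dec_induct)
    case (step n)
    have "P (Suc n) * real (Suc (Suc n)) powr d = P n * ((1 - b (Suc n)) * real (Suc (Suc n)) powr d)"
      by (simp add: P_def mult_ac)
    also have "\<dots> \<le> P n * real (Suc n) powr d"
      using step.hyps by (intro mult_left_mono decay P0)
    finally show ?case using step.IH by simp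
  qed simp
  have "summable (\<lambda>n. real n powr (- d))" using d by (simp add: summable_real_powr_iff)
  then have "summable (\<lambda>n. real (Suc n) powr (- d))" by (subst summable_Suc_iff)
  then have "summable (\<lambda>n. P K * real (Suc K) powr d * real (Suc n) powr (- d))"
    by (rule summable_mult)
  moreover have "\<forall>\<^sub>F n in sequentially.
      norm (P n) \<le> P K * real (Suc K) powr d * real (Suc n) powr (- d)"
    using eventually_ge_at_top[of K]
  proof eventually_elim
    case (elim n)
    show ?case using bd[OF elim] P0[of n]
      by (simp add: powr_minus field_simps)
  qed
  ultimately have "summable P" by (rule summable_comparison_test_ev[rotated])
  then show ?thesis by (simp add: P_def[abs_def])
qed

text \<open>Once \<open>a k \<le> 1 / real k\<close>, each new factor satisfies
  \<open>(1 - a (Suc n)) * real (Suc n) \<ge> real n\<close>, so \<open>P n * real n\<close> is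
  nondecreasing and \<open>P n\<close> dominates a multiple of the harmonic terms.\<close>

lemma not_summable_prod_one_minus:
  fixes a :: "nat \<Rightarrow> real"
  assumes a: "\<And>k. a k < 1" and ev: "\<forall>\<^sub>F k in sequentially. a k \<le> 1 / real k"
  shows "\<not> summable (\<lambda>n. \<Prod>i<n. 1 - a (Suc i))"
proof
  define P where "P n = (\<Prod>i<n. 1 - a (Suc i))" for n
  assume "summable (\<lambda>n. \<Prod>i<n. 1 - a (Suc i))"
  then have sm: "summable P" by (simp add: P_def[abs_def])
  have P0: "0 < P n" for n unfolding P_def using a by (intro prod_pos) auto
  obtain K where K: "\<And>k. K \<le> k \<Longrightarrow> a k \<le> 1 / real k"
    using ev by (auto simp: eventually_sequentially)
  \<comment> \<open>The comparison starts at \<open>Suc K\<close> because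
    \<open>P K * real K\<close> would vanish for \<open>K = 0\<close>, and the constant
    \<open>C\<close> has to be positive.\<close>
  have bd: "P (Suc K) * real (Suc K) \<le> P n * real n" if "Suc K \<le> n" for n
    using that
  proof (induction n rule: dec_induct)
    case (step n)
    have "real n \<le> (1 - a (Suc n)) * real (Suc n)"
      using K[of "Suc n"] step.hyps by (simp add: field_simps)
    from mult_left_mono[OF this, of "P n"] P0[of n]
    have "P n * real n \<le> P (Suc n) * real (Suc n)"
      by (simp add: P_def mult_ac)
    with step.IH show ?case by simp
  qed simp
  define C where "C = P (Suc K) * real (Suc K)"
  have C: "C > 0" using P0 by (simp add: C_def)
  have "summable (\<lambda>n. P n / C)" using sm by (rule summable_divide)
  moreover have "\<forall>\<^sub>F n in sequentially. norm (inverse (real n)) \<le> P n / C"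
    using eventually_ge_at_top[of "Suc K"]
  proof eventually_elim
    case (elim n)
    show ?case using bd[OF elim] C elim unfolding C_def[symmetric]
      by (simp add: field_simps)
  qed
  ultimately have "summable (\<lambda>n. inverse (real n))" by (rule summable_comparison_test_ev[rotated])
  then show False using not_summable_harmonic by blast
qed

section \<open>Joint independence of finite and combined families\<close>

lemma (in prob_space) indep_vars_prob_Ball:
  assumes X: "indep_vars S X I" and J: "finite J" "J \<subseteq> I"
    and A: "\<And>i. i \<in> J \<Longrightarrow> A i \<in> sets (S i)"
  shows "prob {\<omega> \<in> space M. \<forall>i\<in>J. X i \<omega> \<in> A i} = (\<Prod>i\<in>J. prob {\<omega> \<in> space M. X i \<omega> \<in> A i})"
proof (cases "J = {}")
  case True
  then show ?thesis by (simp add: prob_space)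
next
  case False
  have "{\<omega> \<in> space M. \<forall>i\<in>J. X i \<omega> \<in> A i} = (\<Inter>i\<in>J. X i -` A i \<inter> space M)"
    using False by auto
  moreover have "{\<omega> \<in> space M. X i \<omega> \<in> A i} = X i -` A i \<inter> space M" for i by auto
  ultimately show ?thesis using indep_varsD[OF X False J A] by simp
qed

text \<open>A finite set of indices splits into its left and right parts: \<open>XY\<close> factors
  the two parts, and \<open>X\<close> and \<open>Y\<close> factor each part further. This allows the
  marks and radii to be merged into one family and regrouped by site.\<close>

lemma (in prob_space) indep_vars_Plus:
  fixes X :: "'i \<Rightarrow> 'a \<Rightarrow> 'c" and Y :: "'i \<Rightarrow> 'a \<Rightarrow> 'c"
  assumes X: "indep_vars S X I" and Y: "indep_vars T Y J"
    and XY: "indep_var (PiM I S) (\<lambda>\<omega>. restrict (\<lambda>i. X i \<omega>) I) (PiM J T) (\<lambda>\<omega>. restrict (\<lambda>j. Y j \<omega>) J)"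
  shows "indep_vars (case_sum S T) (case_sum X Y) (I <+> J)"
  unfolding indep_vars_def2
proof (intro conjI ballI indep_setsI)
  fix i assume "i \<in> I <+> J"
  then show "random_variable (case_sum S T i) (case_sum X Y i)"
    using X Y by (auto simp: indep_vars_def2)
  then show "{case_sum X Y i -` A \<inter> space M |A. A \<in> sets (case_sum S T i)} \<subseteq> events"
    by (auto intro: measurable_sets)
next
  fix A K assume K: "K \<noteq> {}" "K \<subseteq> I <+> J" "finite K"
    and A: "\<forall>j\<in>K. A j \<in> {case_sum X Y j -` A \<inter> space M |A. A \<in> sets (case_sum S T j)}"
  from A obtain B where B: "\<And>j. j \<in> K \<Longrightarrow> A j = case_sum X Y j -` B j \<inter> space M"
      "\<And>j. j \<in> K \<Longrightarrow> B j \<in> sets (case_sum S T j)"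
    by simp metis
  define I' where "I' = Inl -` K"
  define J' where "J' = Inr -` K"
  have K_eq: "K = I' <+> J'"
    using K(2) by (auto simp: I'_def J'_def)
  have sub: "I' \<subseteq> I" "J' \<subseteq> J" using K(2) by (auto simp: I'_def J'_def)
  have fin: "finite I'" "finite J'" using K(3) by (auto simp: K_eq)
  have setsI: "B (Inl i) \<in> sets (S i)" if "i \<in> I'" for i using B(2)[of "Inl i"] that by (auto simp: I'_def)
  have setsJ: "B (Inr i) \<in> sets (T i)" if "i \<in> J'" for i using B(2)[of "Inr i"] that by (auto simp: J'_def)
  have rvX: "X i \<in> measurable M (S i)" if "i \<in> I" for i using X that by (auto simp: indep_vars_def2)
  have rvY: "Y j \<in> measurable M (T j)" if "j \<in> J" for j using Y that by (auto simp: indep_vars_def2)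
  \<comment> \<open>Cylinders over the selected coordinates turn the event into the preimage of the
    rectangle \<open>U \<times> V\<close>, to which \<open>XY\<close> applies.\<close>
  define U where "U = {f \<in> space (PiM I S). \<forall>i\<in>I'. f i \<in> B (Inl i)}"
  define V where "V = {f \<in> space (PiM J T). \<forall>i\<in>J'. f i \<in> B (Inr i)}"
  have U: "U \<in> sets (PiM I S)"
    unfolding U_def using fin sub setsI 
    by (intro sets.sets_Collect_finite_All) (auto intro!: sets_Collect_single)
  have V: "V \<in> sets (PiM J T)"
    unfolding V_def using fin sub setsJ 
    by (intro sets.sets_Collect_finite_All) (auto intro!: sets_Collect_single)
  have "(\<Inter>j\<in>K. A j) = {\<omega> \<in> space M. \<forall>z\<in>K. case_sum X Y z \<omega> \<in> B z}"
    using K(1) B(1) by auto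
  also have "\<dots> = {\<omega> \<in> space M. (\<forall>i\<in>I'. X i \<omega> \<in> B (Inl i)) \<and> (\<forall>j\<in>J'. Y j \<omega> \<in> B (Inr j))}"
    by (simp add: K_eq Plus_def ball_Un)
  also have "\<dots> = (\<lambda>\<omega>. (\<lambda>i\<in>I. X i \<omega>, \<lambda>j\<in>J. Y j \<omega>)) -` (U \<times> V) \<inter> space M"
    using sub measurable_space[OF rvX] measurable_space[OF rvY]
    by (auto simp: U_def V_def space_PiM subset_iff)
  also have "prob \<dots> = prob ((\<lambda>\<omega>. \<lambda>i\<in>I. X i \<omega>) -` U \<inter> space M) * prob ((\<lambda>\<omega>. \<lambda>j\<in>J. Y j \<omega>) -` V \<inter> space M)"
    by (rule indep_varD[OF XY U V])
  also have "(\<lambda>\<omega>. \<lambda>i\<in>I. X i \<omega>) -` U \<inter> space M = {\<omega> \<in> space M. \<forall>i\<in>I'. X i \<omega> \<in> B (Inl i)}"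
    using sub measurable_space[OF rvX] by (auto simp: U_def space_PiM subset_iff)
  also have "(\<lambda>\<omega>. \<lambda>j\<in>J. Y j \<omega>) -` V \<inter> space M = {\<omega> \<in> space M. \<forall>j\<in>J'. Y j \<omega> \<in> B (Inr j)}"
    using sub measurable_space[OF rvY] by (auto simp: V_def space_PiM subset_iff)
  also have "prob {\<omega> \<in> space M. \<forall>i\<in>I'. X i \<omega> \<in> B (Inl i)} = (\<Prod>i\<in>I'. prob (A (Inl i)))"
    using indep_vars_prob_Ball[OF X fin(1) sub(1) setsI]
    by (simp add: B(1) I'_def vimage_def Int_def conj_commute)
  also have "prob {\<omega> \<in> space M. \<forall>j\<in>J'. Y j \<omega> \<in> B (Inr j)} = (\<Prod>j\<in>J'. prob (A (Inr j)))"
    using indep_vars_prob_Ball[OF Y fin(2) sub(2) setsJ]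
    by (simp add: B(1) J'_def vimage_def Int_def conj_commute)
  also have "(\<Prod>i\<in>I'. prob (A (Inl i))) * (\<Prod>j\<in>J'. prob (A (Inr j))) = (\<Prod>j\<in>K. prob (A j))"
    using fin by (simp add: K_eq prod.Plus comp_def)
  finally show "prob (\<Inter>j\<in>K. A j) = (\<Prod>j\<in>K. prob (A j))" .
qed

section \<open>Sources covering an edge for i.i.d. radii\<close>

text \<open>
  Source \<open>i\<close> sits at site \<open>i + 1\<close>, so it covers the edge \<open>[n, n + 1]\<close> iff \<open>i < n\<close> and
  \<open>n \<le> i + Y i\<close>.
\<close>

locale iid_radii = prob_space M for M :: "'a measure" +
  fixes Y :: "nat \<Rightarrow> 'a \<Rightarrow> nat" and g :: "nat \<Rightarrow> real"
  assumes indep: "indep_vars (\<lambda>_. count_space UNIV) Y UNIV"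
    and tail: "\<And>i k. 1 \<le> k \<Longrightarrow> prob {\<omega> \<in> space M. k \<le> Y i \<omega>} = g k"
begin

lemma Y_measurable [measurable]: "Y i \<in> measurable M (count_space UNIV)"
  using indep by (auto simp: indep_vars_def2)

lemma tail_bounds: "1 \<le> k \<Longrightarrow> 0 \<le> g k" "1 \<le> k \<Longrightarrow> g k \<le> 1"
  using tail[of k 0] prob_le_1 measure_nonneg by metis+

lemma prob_no_source:
  "prob {\<omega> \<in> space M. \<forall>i<n. i + Y i \<omega> < n} = (\<Prod>i<n. 1 - g (Suc i))"
proof -
  have "{\<omega> \<in> space M. \<forall>i<n. i + Y i \<omega> < n} = {\<omega> \<in> space M. \<forall>i\<in>{..<n}. Y i \<omega> \<in> {..<n - i}}"
    by (auto simp: less_diff_conv add.commute)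
  also have "prob \<dots> = (\<Prod>i<n. prob {\<omega> \<in> space M. Y i \<omega> \<in> {..<n - i}})"
    by (rule indep_vars_prob_Ball[OF indep]) auto
  \<comment> \<open>Writing \<open>n - i\<close> as \<open>Suc (n - Suc i)\<close> prepares the
    reversal of the order of the factors.\<close>
  also have "\<dots> = (\<Prod>i<n. 1 - g (Suc (n - Suc i)))"
  proof (rule prod.cong)
    fix i assume i: "i \<in> {..<n}"
    have "{\<omega> \<in> space M. Y i \<omega> \<in> {..<n - i}} = {\<omega> \<in> space M. \<not> n - i \<le> Y i \<omega>}" by auto
    also have "prob \<dots> = 1 - prob {\<omega> \<in> space M. n - i \<le> Y i \<omega>}"
      by (rule prob_neg) measurable
    finally show "prob {\<omega> \<in> space M. Y i \<omega> \<in> {..<n - i}} = 1 - g (Suc (n - Suc i))"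
      using i by (simp add: tail Suc_diff_Suc)
  qed simp
  also have "\<dots> = (\<Prod>i<n. 1 - g (Suc i))"
    by (rule prod.nat_diff_reindex)
  finally show ?thesis .
qed

text \<open>With \<open>S\<close> the number of covering sources, \<open>e ^ S\<close> is a product
  of independent factors, each equal to \<open>e\<close> or \<open>1\<close> and with mean
  \<open>1 - (1 - e) * g (n - i)\<close>. On the event in question \<open>e ^ S\<close> is at least
  \<open>e\<close>, since \<open>e \<le> 1\<close>.\<close>

lemma prob_at_most_one_source:
  assumes e: "0 < e" "e \<le> 1"
  shows "prob {\<omega> \<in> space M. card {i. i < n \<and> n \<le> i + Y i \<omega>} \<le> 1}
    \<le> (\<Prod>i<n. 1 - (1 - e) * g (Suc i)) / e"
proof -
  define f where "f i y = (if n \<le> i + y then e else 1)" for i y :: nat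
  have f01: "0 \<le> f i y" "f i y \<le> 1" for i y using e by (auto simp: f_def)
  have f_int: "integrable M (\<lambda>\<omega>. f i (Y i \<omega>))" for i
    by (rule integrable_const_bound[where B = 1]) (use f01 in auto)
  have prod_f: "(\<Prod>i<n. f i (Y i \<omega>)) = e ^ card {i. i < n \<and> n \<le> i + Y i \<omega>}" for \<omega>
  proof -
    have "(\<Prod>i<n. f i (Y i \<omega>)) = (\<Prod>i\<in>{..<n} \<inter> {i. n \<le> i + Y i \<omega>}. e)"
      unfolding f_def by (subst prod.If_cases) auto
    also have "{..<n} \<inter> {i. n \<le> i + Y i \<omega>} = {i. i < n \<and> n \<le> i + Y i \<omega>}" by auto
    finally show ?thesis by simp
  qed
  have ind: "indep_vars (\<lambda>_. borel) (\<lambda>i \<omega>. f i (Y i \<omega>)) {..<n}"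
    by (rule indep_vars_compose2[OF indep_vars_subset[OF indep]]) auto
  have Ef: "expectation (\<lambda>\<omega>. f i (Y i \<omega>)) = 1 - (1 - e) * g (n - i)" if "i < n" for i
  proof -
    have "expectation (\<lambda>\<omega>. f i (Y i \<omega>)) =
        expectation (\<lambda>\<omega>. 1 - (1 - e) * indicat_real {\<omega> \<in> space M. n - i \<le> Y i \<omega>} \<omega>)"
      by (intro Bochner_Integration.integral_cong) (auto simp: f_def indicator_def)
    also have "\<dots> = 1 - (1 - e) * g (n - i)"
      using that by (subst Bochner_Integration.integral_diff) (auto simp: tail prob_space emeasure_eq_measure intro!: integrable_real_indicator)
    finally show ?thesis .
  qed
  have "prob {\<omega> \<in> space M. card {i. i < n \<and> n \<le> i + Y i \<omega>} \<le> 1} * e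
      = expectation (\<lambda>\<omega>. indicat_real {\<omega> \<in> space M. card {i. i < n \<and> n \<le> i + Y i \<omega>} \<le> 1} \<omega> * e)"
    by simp
  also have "\<dots> \<le> expectation (\<lambda>\<omega>. \<Prod>i<n. f i (Y i \<omega>))"
  proof (rule integral_mono)
    show "integrable M (\<lambda>\<omega>. \<Prod>i<n. f i (Y i \<omega>))"
      by (rule integrable_const_bound[where B = 1])
        (use f01 in \<open>auto intro!: prod_le_1 simp: abs_prod\<close>)
    show "indicat_real {\<omega> \<in> space M. card {i. i < n \<and> n \<le> i + Y i \<omega>} \<le> 1} \<omega> * e
        \<le> (\<Prod>i<n. f i (Y i \<omega>))" for \<omega>
      unfolding prod_f using e power_decreasing[of _ 1 e] by (auto simp: indicator_def)
  qed (auto simp: emeasure_eq_measure intro!: integrable_mult_left integrable_real_indicator)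
  also have "\<dots> = (\<Prod>i<n. expectation (\<lambda>\<omega>. f i (Y i \<omega>)))"
    by (rule indep_vars_lebesgue_integral[OF _ ind]) (auto simp: f_int)
  also have "\<dots> = (\<Prod>i<n. 1 - (1 - e) * g (Suc (n - Suc i)))"
    by (intro prod.cong) (auto simp: Ef Suc_diff_Suc)
  also have "\<dots> = (\<Prod>i<n. 1 - (1 - e) * g (Suc i))"
    by (rule prod.nat_diff_reindex)
  finally show ?thesis using e by (simp add: field_simps)
qed

lemma AE_eventually_two_sources:
  assumes c: "1 < c" and ev: "\<forall>\<^sub>F k in sequentially. c / real k \<le> g k"
  shows "AE \<omega> in M. \<forall>\<^sub>F n in sequentially. 2 \<le> card {i. i < n \<and> n \<le> i + Y i \<omega>}"
proof -
  \<comment> \<open>This choice gives \<open>(1 - e) * c = (c + 1) / 2\<close>, so the exponent of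
    decay stays above 1.\<close>
  define e where "e = (1 - 1 / c) / 2"
  have e: "0 < e" "e \<le> 1" "1 < (1 - e) * c" using c by (auto simp: e_def field_simps)
  \<comment> \<open>\<open>tail\<close> fixes \<open>g\<close> at positive arguments only; the value
    0 at \<open>k = 0\<close> secures the bounds that the summability criterion asks for at every
    \<open>k\<close>.\<close>
  define b where "b k = (if k = 0 then 0 else (1 - e) * g k)" for k
  have "summable (\<lambda>n. \<Prod>i<n. 1 - b (Suc i))"
  proof (rule summable_prod_one_minus[OF _ _ e(3)])
    show "0 \<le> b k" "b k \<le> 1" for k
      using e tail_bounds[of k] by (auto simp: b_def intro!: mult_le_one)
    show "\<forall>\<^sub>F k in sequentially. (1 - e) * c / real k \<le> b k"
      using ev eventually_gt_at_top[of 0]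
    proof eventually_elim
      case (elim k)
      then show ?case using e mult_left_mono[OF elim(1), of "1 - e"] by (simp add: b_def)
    qed
  qed
  then have sm: "summable (\<lambda>n. (\<Prod>i<n. 1 - (1 - e) * g (Suc i)) / e)"
    by (intro summable_divide) (simp add: b_def)
  let ?A = "\<lambda>n. {\<omega> \<in> space M. card {i. i < n \<and> n \<le> i + Y i \<omega>} \<le> 1}"
  have "AE \<omega> in M. \<forall>\<^sub>F n in sequentially. \<omega> \<in> space M - ?A n"
  proof (rule borel_cantelli_AE1)
    show "summable (\<lambda>n. prob (?A n))"
      by (rule summable_comparison_test'[OF sm])
        (use prob_at_most_one_source[OF e(1,2)] in auto)
  qed (auto simp: emeasure_eq_measure)
  then show ?thesis
    by eventually_elim (auto elim!: eventually_mono)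
qed

section \<open>Renewal structure of the uncovered edges\<close>

text \<open>Point masses on the natural numbers are differences of consecutive tails, and the tails
  do not depend on the index.\<close>

lemma distr_Y_eq: "distr M (count_space UNIV) (Y i) = distr M (count_space UNIV) (Y j)"
proof (rule measure_eqI_countable[where A = UNIV])
  have "prob {\<omega> \<in> space M. Y i \<omega> = k} = prob {\<omega> \<in> space M. k \<le> Y i \<omega>} - prob {\<omega> \<in> space M. Suc k \<le> Y i \<omega>}" for i k
    by (subst finite_measure_Diff[symmetric]) (auto intro!: arg_cong[where f = prob])
  moreover have "prob {\<omega> \<in> space M. k \<le> Y i \<omega>} = (if k = 0 then 1 else g k)" for i k
    by (simp add: tail prob_space)
  ultimately have "prob {\<omega> \<in> space M. Y i \<omega> = k} = prob {\<omega> \<in> space M. Y j \<omega> = k}" for k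
    by simp
  then show "emeasure (distr M (count_space UNIV) (Y i)) {k} = emeasure (distr M (count_space UNIV) (Y j)) {k}" for k
    by (simp add: emeasure_distr emeasure_eq_measure vimage_def Int_def conj_commute)
qed auto

text \<open>By independence both laws are products of their marginals, and all marginals
  agree.\<close>

lemma distr_shift_eq:
  "distr M (PiM UNIV (\<lambda>_. count_space UNIV)) (\<lambda>\<omega> i. Y (m + i) \<omega>)
    = distr M (PiM UNIV (\<lambda>_. count_space UNIV)) (\<lambda>\<omega> i. Y i \<omega>)"
proof -
  have "indep_vars (\<lambda>_. count_space UNIV) (\<lambda>i. Y (m + i)) UNIV"
  proof -
    \<comment> \<open>The shift of indices is obtained by grouping into the disjoint singleton
      blocks \<open>{m + i}\<close> and then projecting each block to its only coordinate.\<close>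
    have "indep_vars (\<lambda>i. PiM {m + i} (\<lambda>_. count_space UNIV)) (\<lambda>i \<omega>. restrict (\<lambda>k. Y k \<omega>) {m + i}) UNIV"
      by (rule indep_vars_restrict[OF indep]) (auto simp: disjoint_family_on_def)
    from indep_vars_compose2[OF this, of "\<lambda>i f. f (m + i)" "\<lambda>_. count_space UNIV"]
    show ?thesis by simp
  qed
  then have "distr M (PiM UNIV (\<lambda>_. count_space UNIV)) (\<lambda>\<omega> i. Y (m + i) \<omega>)
      = PiM UNIV (\<lambda>i. distr M (count_space UNIV) (Y (m + i)))"
    by (subst (asm) indep_vars_iff_distr_eq_PiM) (auto simp: restrict_UNIV)
  also have "\<dots> = PiM UNIV (\<lambda>i. distr M (count_space UNIV) (Y i))"
    by (intro PiM_cong refl distr_Y_eq)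
  also have "\<dots> = distr M (PiM UNIV (\<lambda>_. count_space UNIV)) (\<lambda>\<omega> i. Y i \<omega>)"
    using indep by (subst (asm) indep_vars_iff_distr_eq_PiM) (auto simp: restrict_UNIV)
  finally show ?thesis .
qed

text \<open>Only sources from \<open>m\<close> on enter, so the event is independent of the earlier
  radii. If edge \<open>m\<close> is uncovered, the earlier sources reach no later edge either, and
  the event says that \<open>m\<close> is the last renewal.\<close>

definition no_return :: "nat \<Rightarrow> 'a set" where
  "no_return m = {\<omega> \<in> space M. \<forall>n>m. \<exists>i\<in>{m..<n}. n \<le> i + Y i \<omega>}"

lemma no_return_sets [measurable]: "no_return m \<in> sets M"
  unfolding no_return_def by measurable

text \<open>Each of these events is the preimage of one fixed set \<open>S\<close> of sequences
  under the shifted radii, whose law does not depend on the shift.\<close>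

lemma prob_no_return: "prob (no_return m) = prob (no_return 0)"
proof -
  let ?P = "PiM UNIV (\<lambda>_::nat. count_space (UNIV :: nat set))"
  define S where "S = {w \<in> space ?P. \<forall>n>0. \<exists>i\<in>{..<n}. n \<le> i + w i}"
  have S: "S \<in> sets ?P" unfolding S_def by measurable
  have "no_return m = (\<lambda>\<omega> i. Y (m + i) \<omega>) -` S \<inter> space M" for m
  proof (intro set_eqI iffI)
    fix \<omega> assume \<omega>: "\<omega> \<in> no_return m"
    have "\<exists>i\<in>{..<n}. n \<le> i + Y (m + i) \<omega>" if "n > 0" for n
    proof -
      from \<omega> that have "\<exists>i\<in>{m..<m + n}. m + n \<le> i + Y i \<omega>" by (simp add: no_return_def)
      then obtain i where "m \<le> i" "i < m + n" "m + n \<le> i + Y i \<omega>" by auto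
      then show ?thesis by (intro bexI[of _ "i - m"]) auto
    qed
    with \<omega> show "\<omega> \<in> (\<lambda>\<omega> i. Y (m + i) \<omega>) -` S \<inter> space M"
      by (auto simp: S_def no_return_def space_PiM)
  next
    fix \<omega> assume \<omega>: "\<omega> \<in> (\<lambda>\<omega> i. Y (m + i) \<omega>) -` S \<inter> space M"
    have "\<exists>i\<in>{m..<n}. n \<le> i + Y i \<omega>" if "n > m" for n
    proof -
      from \<omega> that have "\<exists>i\<in>{..<n - m}. n - m \<le> i + Y (m + i) \<omega>" by (simp add: S_def)
      then obtain i where "i < n - m" "n - m \<le> i + Y (m + i) \<omega>" by auto
      then show ?thesis by (intro bexI[of _ "m + i"]) auto
    qed
    with \<omega> show "\<omega> \<in> no_return m" by (auto simp: no_return_def)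
  qed
  then have "prob (no_return m) = measure (distr M ?P (\<lambda>\<omega> i. Y (m + i) \<omega>)) S" for m
    using S by (subst measure_distr) (auto intro!: measurable_PiM_single')
  then show ?thesis using distr_shift_eq[of m] distr_shift_eq[of 0] by simp
qed

text \<open>The first event is determined by the radii below \<open>m\<close> and the second by
  those from \<open>m\<close> on, so the probability factors.\<close>

lemma prob_last_renewal:
  "prob ({\<omega> \<in> space M. \<forall>i<m. i + Y i \<omega> < m} \<inter> no_return m)
    = (\<Prod>i<m. 1 - g (Suc i)) * prob (no_return 0)"
proof -
  let ?P = "\<lambda>I. PiM I (\<lambda>_::nat. count_space (UNIV :: nat set))"
  define U where "U = {w \<in> space (?P {..<m}). \<forall>i\<in>{..<m}. i + w i < m}"
  define V where "V = {w \<in> space (?P {m..}). \<forall>n>m. \<exists>i\<in>{m..<n}. n \<le> i + w i}"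
  have U: "U \<in> sets (?P {..<m})" unfolding U_def by measurable
  have V: "V \<in> sets (?P {m..})" unfolding V_def by measurable
  have U_eq: "(\<lambda>\<omega>. \<lambda>i\<in>{..<m}. Y i \<omega>) -` U \<inter> space M = {\<omega> \<in> space M. \<forall>i<m. i + Y i \<omega> < m}"
    by (auto simp: U_def space_PiM)
  have V_eq: "(\<lambda>\<omega>. \<lambda>i\<in>{m..}. Y i \<omega>) -` V \<inter> space M = no_return m"
    by (auto simp: V_def no_return_def space_PiM)
  have "indep_var (?P {..<m}) (\<lambda>\<omega>. \<lambda>i\<in>{..<m}. Y i \<omega>) (?P {m..}) (\<lambda>\<omega>. \<lambda>i\<in>{m..}. Y i \<omega>)"
    by (rule indep_var_restrict[OF indep]) auto
  from indep_varD[OF this U V] have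
    "prob ((\<lambda>\<omega>. (\<lambda>i\<in>{..<m}. Y i \<omega>, \<lambda>i\<in>{m..}. Y i \<omega>)) -` (U \<times> V) \<inter> space M)
      = (\<Prod>i<m. 1 - g (Suc i)) * prob (no_return 0)"
    unfolding U_eq V_eq prob_no_source prob_no_return[of m] .
  moreover have "(\<lambda>\<omega>. (\<lambda>i\<in>{..<m}. Y i \<omega>, \<lambda>i\<in>{m..}. Y i \<omega>)) -` (U \<times> V) \<inter> space M
      = {\<omega> \<in> space M. \<forall>i<m. i + Y i \<omega> < m} \<inter> no_return m"
    unfolding U_eq[symmetric] V_eq[symmetric] by auto
  ultimately show ?thesis by simp
qed

text \<open>The events of a last renewal at \<open>m\<close> are disjoint, so their probabilities
  are summable. The renewal probabilities themselves are not, which forces the common factor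
  \<open>prob (no_return 0)\<close> to be 0. The assumption \<open>g 1 < 1\<close> keeps all factors
  \<open>1 - g k\<close> with \<open>1 \<le> k\<close> positive.\<close>

lemma AE_frequently_no_source:
  assumes g: "g 1 < 1" and ev: "\<forall>\<^sub>F k in sequentially. g k \<le> 1 / real k"
  shows "AE \<omega> in M. \<forall>N. \<exists>n\<ge>N. \<forall>i<n. i + Y i \<omega> < n"
proof -
  let ?E = "\<lambda>m. {\<omega> \<in> space M. \<forall>i<m. i + Y i \<omega> < m} \<inter> no_return m"
  have tail_less_1: "g k < 1" if "1 \<le> k" for k
  proof -
    have "prob {\<omega> \<in> space M. k \<le> Y 0 \<omega>} \<le> prob {\<omega> \<in> space M. 1 \<le> Y 0 \<omega>}"
      using that by (intro finite_measure_mono) auto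
    then show ?thesis using g that by (simp add: tail)
  qed
  have "\<not> summable (\<lambda>n. \<Prod>i<n. 1 - (if Suc i = 0 then 0 else g (Suc i)))"
    by (rule not_summable_prod_one_minus)
      (use tail_less_1 ev in \<open>auto elim!: eventually_mono\<close>)
  then have ns: "\<not> summable (\<lambda>n. \<Prod>i<n. 1 - g (Suc i))" by simp
  have "disjoint_family ?E"
  proof -
    \<comment> \<open>Under \<open>no_return m\<close> some source reaches edge \<open>n\<close>,
      which contradicts a renewal at \<open>n\<close>.\<close>
    have "\<omega> \<notin> ?E n" if "m < n" "\<omega> \<in> ?E m" for m n \<omega>
    proof
      assume n: "\<omega> \<in> ?E n"
      from that have "\<exists>i\<in>{m..<n}. n \<le> i + Y i \<omega>" by (simp add: no_return_def)
      then obtain i where "i < n" "n \<le> i + Y i \<omega>" by auto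
      with n show False by (auto simp: not_less[symmetric])
    qed
    then have "?E m \<inter> ?E n = {}" if "m \<noteq> n" for m n
      using that by (cases m n rule: linorder_cases) blast+
    then show ?thesis unfolding disjoint_family_on_def by blast
  qed
  then have "summable (\<lambda>m. prob (?E m))"
    by (intro sums_summable[OF finite_measure_UNION]) auto
  then have sm: "summable (\<lambda>m. (\<Prod>i<m. 1 - g (Suc i)) * prob (no_return 0))"
    by (simp only: prob_last_renewal)
  have "prob (no_return 0) = 0"
  proof (rule ccontr)
    assume "prob (no_return 0) \<noteq> 0"
    with summable_divide[OF sm, of "prob (no_return 0)"] have "summable (\<lambda>m. \<Prod>i<m. 1 - g (Suc i))"
      by (simp only: nonzero_mult_div_cancel_right not_False_eq_True)
    with ns show False ..
  qed
  then have "prob (no_return m) = 0" for m using prob_no_return[of m] by (rule trans[rotated])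
  then have "no_return m \<in> null_sets M" for m
    by (auto simp: null_sets_def emeasure_eq_measure)
  then have "AE \<omega> in M. \<forall>m. \<omega> \<notin> no_return m"
    by (subst AE_all_countable) (auto intro: AE_not_in)
  with AE_space show ?thesis
  proof eventually_elim
    case (elim \<omega>)
    show ?case
    proof
      fix N
      show "\<exists>n\<ge>N. \<forall>i<n. i + Y i \<omega> < n"
      proof (induction N)
        case 0
        \<comment> \<open>Edge 0 is a renewal vacuously: no source lies before it.\<close>
        show ?case by (intro exI[of _ 0]) simp
      next
        case (Suc N)
        then obtain n where n: "N \<le> n" "\<forall>i<n. i + Y i \<omega> < n" by blast
        from elim have "\<omega> \<notin> no_return n" "\<omega> \<in> space M" by auto
        then obtain n' where n': "n < n'" "\<forall>i\<in>{n..<n'}. i + Y i \<omega> < n'"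
          by (auto simp: no_return_def not_le)
        \<comment> \<open>Sources before \<open>n\<close> stop short of \<open>n\<close>, hence of
          \<open>n'\<close>; those from \<open>n\<close> on are handled by the failure of
          \<open>no_return n\<close>.\<close>
        have "i + Y i \<omega> < n'" if "i < n'" for i
          using n n' that by (cases "i < n") (auto intro: less_trans)
        with n n' show ?case by (intro exI[of _ n']) auto
      qed
    qed
  qed
qed

end

section \<open>Reduction of real rays to integer edges\<close>

text \<open>This expresses that the edge \<open>[n, n + 1]\<close> lies in two of the intervals. An
  interval containing the edge starts at or before \<open>n\<close>, so a finite index range
  suffices, which makes measurability immediate.\<close>

definition twice_covered :: "(int \<Rightarrow> 'a \<Rightarrow> nat) \<Rightarrow> (int \<Rightarrow> 'a \<Rightarrow> nat) \<Rightarrow> nat \<Rightarrow> 'a \<Rightarrow> bool" where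
  "twice_covered X R n \<omega> \<longleftrightarrow> (\<exists>j\<in>{-1..int n}. \<exists>k\<in>{-1..int n}. j \<noteq> k \<and> X j \<omega> = 1 \<and> X k \<omega> = 1 \<and>
     int n + 1 \<le> j + int (R j \<omega>) \<and> int n + 1 \<le> k + int (R k \<omega>))"

text \<open>All intervals have integer endpoints, so one that meets the interior of an edge contains
  the whole edge.\<close>

lemma ray_subset_sceptic_region_iff:
  "(\<exists>t. {t..} \<subseteq> sceptic_region X R \<omega>) \<longleftrightarrow> (\<exists>N. \<forall>n\<ge>N. twice_covered X R n \<omega>)"
proof
  assume "\<exists>t. {t..} \<subseteq> sceptic_region X R \<omega>"
  then obtain t where t: "{t..} \<subseteq> sceptic_region X R \<omega>" by blast
  obtain N :: nat where N: "t \<le> real N" using real_arch_simple by blast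
  have "twice_covered X R n \<omega>" if "N \<le> n" for n
  proof -
    \<comment> \<open>The midpoint is tested because an interval may touch an endpoint of the edge
      without covering it.\<close>
    from N that have "real n + 1/2 \<in> {t..}" by simp
    with t have "real n + 1/2 \<in> sceptic_region X R \<omega>" by blast
    then obtain j k where jk: "-1 \<le> j" "-1 \<le> k" "j \<noteq> k" "X j \<omega> = 1" "X k \<omega> = 1"
      "real_of_int j \<le> real n + 1/2" "real n + 1/2 \<le> real_of_int j + real (R j \<omega>)"
      "real_of_int k \<le> real n + 1/2" "real n + 1/2 \<le> real_of_int k + real (R k \<omega>)"
      by (auto simp: sceptic_region_def)
    have "j \<le> int n" "int n + 1 \<le> j + int (R j \<omega>)" "k \<le> int n" "int n + 1 \<le> k + int (R k \<omega>)"
      using jk(6-9) by linarith+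
    with jk show ?thesis
      unfolding twice_covered_def by (intro bexI[of _ j] bexI[of _ k]) auto
  qed
  then show "\<exists>N. \<forall>n\<ge>N. twice_covered X R n \<omega>" by blast
next
  assume "\<exists>N. \<forall>n\<ge>N. twice_covered X R n \<omega>"
  then obtain N where N: "\<And>n. N \<le> n \<Longrightarrow> twice_covered X R n \<omega>" by blast
  have "x \<in> sceptic_region X R \<omega>" if "real N \<le> x" for x
  proof -
    define n where "n = nat \<lfloor>x\<rfloor>"
    have n: "N \<le> n" "real n \<le> x" "x \<le> real n + 1"
      using that unfolding n_def by linarith+
    from N[OF n(1)] obtain j k where jk: "-1 \<le> j" "-1 \<le> k" "j \<noteq> k" "X j \<omega> = 1" "X k \<omega> = 1"
      "j \<le> int n" "int n + 1 \<le> j + int (R j \<omega>)" "k \<le> int n" "int n + 1 \<le> k + int (R k \<omega>)"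
      unfolding twice_covered_def by auto
    have "real_of_int j \<le> x" "x \<le> real_of_int j + real (R j \<omega>)"
      "real_of_int k \<le> x" "x \<le> real_of_int k + real (R k \<omega>)"
      using jk(6-9) n by linarith+
    with jk show ?thesis unfolding sceptic_region_def by auto
  qed
  then show "\<exists>t. {t..} \<subseteq> sceptic_region X R \<omega>" by (intro exI[of _ "real N"]) auto
qed

section \<open>From the firework process to i.i.d. radii\<close>

context firework_process
begin

text \<open>The shift by 1 starts the sources at site 1, since \<open>X\<close> is constantly 1 at
  sites \<open>-1\<close> and \<open>0\<close> and would spoil the identical distribution. Radius 0
  encodes a silent individual because it covers no edge.\<close>

definition eff_radius :: "nat \<Rightarrow> 'a \<Rightarrow> nat" where
  "eff_radius i \<omega> = (if X (int i + 1) \<omega> = 1 then R (int i + 1) \<omega> else 0)"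

text \<open>This is the tail of \<open>eff_radius\<close> for positive \<open>k\<close>; at
  \<open>k = 0\<close> it equals \<open>p\<close>, not 1.\<close>

definition tail_prob :: "nat \<Rightarrow> real" where
  "tail_prob k = p * measure N {\<omega> \<in> space N. k \<le> \<rho> \<omega>}"

lemma X_measurable: "-1 \<le> i \<Longrightarrow> X i \<in> measurable M (count_space UNIV)"
proof (cases "1 \<le> i")
  case True
  then show ?thesis using X_indep by (auto simp: indep_vars_def2)
next
  case False
  assume "-1 \<le> i"
  with False have "i \<in> {-1, 0}" by auto
  then show ?thesis using X_initial by (subst measurable_cong[where g = "\<lambda>_. 1"]) auto
qed

lemma R_measurable: "-1 \<le> i \<Longrightarrow> R i \<in> measurable M (count_space UNIV)"
  using R_indep by (auto simp: indep_vars_def2)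

text \<open>The passage to \<open>twice_covered\<close> replaces quantifiers over real numbers by
  countable ones.\<close>

lemma ray_event: "{\<omega> \<in> space M. \<exists>t. {t..} \<subseteq> sceptic_region X R \<omega>} \<in> sets M"
proof -
  have XR: "{\<omega> \<in> space M. X j \<omega> = 1} \<in> sets M"
    "{\<omega> \<in> space M. int n + 1 \<le> j + int (R j \<omega>)} \<in> sets M" if "-1 \<le> j" for j n
    using measurable_sets[OF X_measurable[OF that], of "{1}"]
      measurable_sets[OF R_measurable[OF that], of "{r. int n + 1 \<le> j + int r}"]
    by (simp_all add: vimage_def Int_def conj_commute)
  have "{\<omega> \<in> space M. twice_covered X R n \<omega>} \<in> sets M" for n
    unfolding twice_covered_def
    by (intro sets.sets_Collect_finite_Ex sets.sets_Collect_conj sets.sets_Collect_const XR) auto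
  then have "{\<omega> \<in> space M. \<exists>N. \<forall>n\<ge>N. twice_covered X R n \<omega>} \<in> sets M"
    by (intro sets.sets_Collect_countable_Ex sets.sets_Collect_countable_All sets.sets_Collect_imp
      sets.sets_Collect_const)
  then show ?thesis by (simp only: ray_subset_sceptic_region_iff)
qed

text \<open>Marks and radii form one independent family over a sum type. The blocks
  \<open>K i\<close> collect the two coordinates at site \<open>int i + 1\<close>; they are
  disjoint, so functions of different blocks are independent.\<close>

lemma indep_vars_eff_radius: "indep_vars (\<lambda>_. count_space UNIV) eff_radius UNIV"
proof -
  let ?C = "\<lambda>_. count_space UNIV"
  let ?Z = "case_sum X R"
  define K where "K i = {Inl (int i + 1), Inr (int i + 1)}" for i
  have "indep_vars (case_sum (\<lambda>_. count_space UNIV) (\<lambda>_. count_space UNIV)) ?Z ({1..} <+> {-1..})"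
    by (rule indep_vars_Plus[OF X_indep R_indep X_R_indep])
  also have "case_sum ?C ?C = ?C" by (auto simp: fun_eq_iff split: sum.split)
  finally have "indep_vars (\<lambda>i. PiM (K i) ?C) (\<lambda>i \<omega>. restrict (\<lambda>z. ?Z z \<omega>) (K i)) UNIV"
    by (rule indep_vars_restrict) (auto simp: K_def disjoint_family_on_def)
  then have "indep_vars ?C (\<lambda>i \<omega>. (\<lambda>f. if f (Inl (int i + 1)) = 1 then f (Inr (int i + 1)) else 0)
      (restrict (\<lambda>z. ?Z z \<omega>) (K i))) UNIV"
  proof (rule indep_vars_compose2)
    fix i
    have [measurable]: "(\<lambda>f. f z) \<in> measurable (PiM (K i) ?C) (count_space UNIV)" if "z \<in> K i" for z
      using that by (rule measurable_component_singleton)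
    show "(\<lambda>f. if f (Inl (int i + 1)) = (1::nat) then f (Inr (int i + 1)) else (0::nat))
        \<in> measurable (PiM (K i) ?C) (count_space UNIV)"
      by (measurable; simp add: K_def)
  qed
  then show ?thesis by (simp add: K_def eff_radius_def[abs_def] cong: if_cong)
qed

text \<open>As \<open>k\<close> is positive, a silent site cannot contribute, so the event says that
  the mark is 1 and the radius at least \<open>k\<close>; these are independent.\<close>

lemma prob_eff_radius_ge:
  assumes "1 \<le> k"
  shows "prob {\<omega> \<in> space M. k \<le> eff_radius i \<omega>} = tail_prob k"
proof -
  define s where "s = int i + 1"
  have s: "1 \<le> s" by (simp add: s_def)
  let ?PX = "PiM {1::int..} (\<lambda>_. count_space (UNIV :: nat set))"
  let ?PR = "PiM {-1::int..} (\<lambda>_. count_space (UNIV :: nat set))"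
  define U where "U = {f \<in> space ?PX. f s \<in> {1}}"
  define V where "V = {f \<in> space ?PR. f s \<in> {k..}}"
  have U: "U \<in> sets ?PX" unfolding U_def using s by (intro sets_Collect_single) auto
  have V: "V \<in> sets ?PR" unfolding V_def using s by (intro sets_Collect_single) auto
  have "{\<omega> \<in> space M. k \<le> eff_radius i \<omega>} = (\<lambda>\<omega>. (\<lambda>i\<in>{1..}. X i \<omega>, \<lambda>i\<in>{-1..}. R i \<omega>)) -` (U \<times> V) \<inter> space M"
    using assms s by (auto simp: eff_radius_def U_def V_def space_PiM s_def[symmetric] split: if_splits)
  also have "prob \<dots> = prob ((\<lambda>\<omega>. \<lambda>i\<in>{1..}. X i \<omega>) -` U \<inter> space M) * prob ((\<lambda>\<omega>. \<lambda>i\<in>{-1..}. R i \<omega>) -` V \<inter> space M)"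
    by (rule indep_varD[OF X_R_indep U V])
  also have "(\<lambda>\<omega>. \<lambda>i\<in>{1..}. X i \<omega>) -` U \<inter> space M = {\<omega> \<in> space M. X s \<omega> = 1}"
    using s by (auto simp: U_def space_PiM)
  also have "(\<lambda>\<omega>. \<lambda>i\<in>{-1..}. R i \<omega>) -` V \<inter> space M = R s -` {k..} \<inter> space M"
    using s by (auto simp: V_def space_PiM)
  also have "prob \<dots> = measure (distr M (count_space UNIV) (R s)) {k..}"
    using s by (subst measure_distr) (auto intro: R_measurable)
  also have "\<dots> = measure N {\<omega> \<in> space N. k \<le> \<rho> \<omega>}"
    using s R_distr[of s] radius_measurable
    by (simp add: measure_distr vimage_def Int_def conj_commute)
  finally show ?thesis using X_one[OF s] by (simp add: tail_prob_def)
qed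

sublocale sources: iid_radii M eff_radius tail_prob
  by unfold_locales (fact indep_vars_eff_radius, fact prob_eff_radius_ge)

text \<open>The sources at sites from 1 on already cover every late edge twice.\<close>

lemma AE_ray_if_tail_large:
  assumes "1 < c" "\<forall>\<^sub>F k in sequentially. c / real k \<le> tail_prob k"
  shows "AE \<omega> in M. \<exists>t. {t..} \<subseteq> sceptic_region X R \<omega>"
  using sources.AE_eventually_two_sources[OF assms]
proof eventually_elim
  case (elim \<omega>)
  then obtain N where N: "\<And>n. N \<le> n \<Longrightarrow> 2 \<le> card {i. i < n \<and> n \<le> i + eff_radius i \<omega>}"
    by (auto simp: eventually_sequentially)
  have "twice_covered X R n \<omega>" if "N \<le> n" for n
  proof -
    define S where "S = {i. i < n \<and> n \<le> i + eff_radius i \<omega>}"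
    have "\<not> card S \<le> Suc 0" "finite S" using N[OF that] by (auto simp: S_def)
    then obtain i j where ij: "i \<in> S" "j \<in> S" "i \<noteq> j"
      using card_le_Suc0_iff_eq[of S] by blast
    have covers: "X (int i + 1) \<omega> = 1 \<and> int n + 1 \<le> int i + 1 + int (R (int i + 1) \<omega>)"
      if "i < n" "n \<le> i + eff_radius i \<omega>" for i
      using that by (auto simp: eff_radius_def split: if_splits)
    show ?thesis unfolding twice_covered_def
      using ij covers[of i] covers[of j] unfolding S_def
      by (intro bexI[of _ "int i + 1"] bexI[of _ "int j + 1"]) auto
  qed
  then show ?case unfolding ray_subset_sceptic_region_iff by blast
qed

text \<open>Infinitely many edges are missed by all sources from site 1 on, and only finitely many
  edges can be reached from \<open>-1\<close> and \<open>0\<close>. So some late edge is not covered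
  even once.\<close>

lemma AE_no_ray_if_tail_small:
  assumes "tail_prob 1 < 1" "\<forall>\<^sub>F k in sequentially. tail_prob k \<le> 1 / real k"
  shows "AE \<omega> in M. \<not> (\<exists>t. {t..} \<subseteq> sceptic_region X R \<omega>)"
  using sources.AE_frequently_no_source[OF assms]
proof eventually_elim
  case (elim \<omega>)
  show ?case unfolding ray_subset_sceptic_region_iff
  proof
    assume "\<exists>N. \<forall>n\<ge>N. twice_covered X R n \<omega>"
    then obtain N where N: "\<And>n. N \<le> n \<Longrightarrow> twice_covered X R n \<omega>" by blast
    \<comment> \<open>The bound by \<open>R (-1) \<omega> + R 0 \<omega>\<close> puts the edge
      beyond the reach of both initial sources.\<close>
    obtain n where n: "max N (R (-1) \<omega> + R 0 \<omega>) \<le> n" "\<And>i. i < n \<Longrightarrow> i + eff_radius i \<omega> < n"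
      using elim by blast
    obtain j where j: "-1 \<le> j" "j \<le> int n" "X j \<omega> = 1" "int n + 1 \<le> j + int (R j \<omega>)"
      using N[of n] n(1) unfolding twice_covered_def by auto
    show False
    proof (cases "1 \<le> j")
      case True
      define i where "i = nat (j - 1)"
      have "j = int i + 1" "i < n" using True j by (auto simp: i_def)
      with n(2)[of i] j show False by (auto simp: eff_radius_def)
    next
      case False
      with j have "j = -1 \<or> j = 0" by auto
      with j n(1) show False by auto
    qed
  qed
qed

end

section \<open>The two regimes in terms of liminf and limsup\<close>

text \<open>Since \<open>measure\<close> takes the default value 0 outside \<open>sets M\<close>,
  the event is also asserted to be measurable, so that the two values are genuine
  probabilities.\<close>

theorem proposition1:
  fixes M :: "'a measure" and N :: "'b measure"
    and p :: real and \<rho> :: "'b \<Rightarrow> nat"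
    and X R :: "int \<Rightarrow> 'a \<Rightarrow> nat"
    and l L :: ereal
  assumes process: "firework_process M N p \<rho> X R"
    and p_range: "p \<in> {0..1}"
    and l_eq: "l = liminf (\<lambda>j::nat. ereal (real j * measure N {\<omega> \<in> space N. j \<le> \<rho> \<omega>}))"
    and L_eq: "L = limsup (\<lambda>j::nat. ereal (real j * measure N {\<omega> \<in> space N. j \<le> \<rho> \<omega>}))"
    and l_gt: "1 < l"
    and L_finite: "L < \<infinity>"
  shows "{\<omega> \<in> space M. \<exists>t. {t..} \<subseteq> sceptic_region X R \<omega>} \<in> sets M \<and>
    (1 / l < ereal p \<longrightarrow>
       percolates_among_sceptics M X R \<and>
       measure M {\<omega> \<in> space M. \<exists>t. {t..} \<subseteq> sceptic_region X R \<omega>} = 1) \<and>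
    (ereal p < 1 / L \<longrightarrow>
       \<not> percolates_among_sceptics M X R \<and>
       measure M {\<omega> \<in> space M. \<exists>t. {t..} \<subseteq> sceptic_region X R \<omega>} = 0)"
proof -
  interpret firework_process M N p \<rho> X R by (rule process)
  define G where "G j = measure N {\<omega> \<in> space N. j \<le> \<rho> \<omega>}" for j
  have "l \<le> L" unfolding l_eq L_eq by (intro Liminf_le_Limsup) simp
  with l_gt L_finite obtain l' L' where lL: "l = ereal l'" "L = ereal L'" "1 < l'" "1 < L'"
    by (cases l; cases L) auto
  have tail: "tail_prob k = p * G k" for k by (simp add: tail_prob_def G_def)
  have "AE \<omega> in M. \<exists>t. {t..} \<subseteq> sceptic_region X R \<omega>" if "1 / l < ereal p"
  proof -
    have p: "1 / p < l'" "0 < p"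
    proof -
      have "1 / l' < p" using that lL by (simp add: one_ereal_def)
      then show "0 < p" using lL by (smt (verit) divide_pos_pos)
      with \<open>1 / l' < p\<close> show "1 / p < l'" using lL by (simp add: field_simps)
    qed
    \<comment> \<open>A constant strictly below the liminf bounds \<open>real j * G j\<close> from
      below eventually, while \<open>1 / p < c\<close> makes \<open>p * c\<close> exceed 1.\<close>
    then obtain c where c: "1 / p < c" "c < l'" using dense by blast
    have "\<forall>\<^sub>F j in sequentially. ereal c < ereal (real j * G j)"
      unfolding G_def by (rule less_LiminfD) (use c lL l_eq in auto)
    then have "\<forall>\<^sub>F j in sequentially. p * c / real j \<le> tail_prob j"
      using eventually_gt_at_top[of 0]
      by eventually_elim (use p in \<open>simp add: tail field_simps\<close>)
    moreover have "1 < p * c" using c p by (simp add: field_simps)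
    ultimately show ?thesis by (rule AE_ray_if_tail_large[rotated])
  qed
  moreover have "AE \<omega> in M. \<not> (\<exists>t. {t..} \<subseteq> sceptic_region X R \<omega>)" if "ereal p < 1 / L"
  proof -
    have pL: "p * L' < 1" using that lL by (simp add: one_ereal_def field_simps)
    \<comment> \<open>As \<open>L' > 1\<close>, the regime \<open>p * L' < 1\<close> forces
      \<open>p < 1\<close>, which gives the strict bound on \<open>tail_prob 1\<close>.\<close>
    have "p * 1 \<le> p * L'" using p_range lL by (intro mult_left_mono) auto
    with pL have "p < 1" by simp
    then have "tail_prob 1 < 1"
      using p_range radius.prob_le_1[of "{\<omega> \<in> space N. 1 \<le> \<rho> \<omega>}"] mult_left_le[of "G 1" p]
      by (simp add: tail G_def)
    moreover have "\<forall>\<^sub>F j in sequentially. tail_prob j \<le> 1 / real j"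
    \<comment> \<open>For \<open>p = 0\<close> the threshold \<open>1 / p\<close> would be 0 by
      convention, so this case is treated apart; there the tail vanishes.\<close>
    proof (cases "p = 0")
      case False
      with p_range have p: "0 < p" by simp
      with pL have "\<forall>\<^sub>F j in sequentially. ereal (real j * G j) < ereal (1 / p)"
        unfolding G_def by (intro Limsup_lessD) (use lL L_eq in \<open>auto simp: field_simps\<close>)
      then show ?thesis
        using eventually_gt_at_top[of 0]
        by eventually_elim (use p in \<open>simp add: tail field_simps\<close>)
    next
      case True
      then have "tail_prob j = 0" for j using tail[of j] by (metis mult_zero_left)
      then show ?thesis by simp
    qed
    ultimately show ?thesis by (rule AE_no_ray_if_tail_small)
  qed
  moreover have "percolates_among_sceptics M X R" if "AE \<omega> in M. \<exists>t. {t..} \<subseteq> sceptic_region X R \<omega>"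
    unfolding percolates_among_sceptics_def using that
  proof eventually_elim
    case (elim \<omega>)
    then obtain t where "{t..} \<subseteq> sceptic_region X R \<omega>" by blast
    then show ?case by (intro exI[of _ "max 1 t"]) auto
  qed
  moreover have "\<not> percolates_among_sceptics M X R"
    if "AE \<omega> in M. \<not> (\<exists>t. {t..} \<subseteq> sceptic_region X R \<omega>)"
  proof
    assume "percolates_among_sceptics M X R"
    then have "AE \<omega> in M. \<exists>t\<ge>1. {t..} \<subseteq> sceptic_region X R \<omega>"
      by (simp add: percolates_among_sceptics_def)
    with that have "AE \<omega> in M. False" by eventually_elim blast
    then show False by simp
  qed
  ultimately show ?thesis
    using ray_event by (simp add: prob_Collect_eq_1 prob_Collect_eq_0)
qed

end
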